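(* Let $X$ be a Banach space and let $A$ be a continuous map from $\mathbb{R}$ to the space of bounded linear operators on $X$ with $N:=\sup_{t\in\mathbb{R}}\|A(t)\|<\infty$, such that the linear equation $x'=A(t)x$ admits a partial exponential dichotomy. Then there is $c_0>0$ such that for every $c\in(0,c_0]$ and every continuous map $f\colon\mathbb{R}\times X\to X$ with $f(\cdot,0)=0$ and $\|f(t,x)-f(t,y)\|\le c\|x-y\|$ for all $t\in\mathbb{R}$ and $x,y\in X$, there exists $L>0$ with the following property: for any $\varepsilon>0$ and any differentiable function $y\colon\mathbb{R}\to X$ such that $$\sup_{t\in\mathbb{R}}\|y'(t)-A(t)y(t)-f(t,y(t))\|\le\delta:=L\varepsilon,$$ there exists $x\colon\mathbb{R}\to X$ such that: (1) for each $n\in\mathbb{Z}$, $x|_{(n,n+1)}$ is a solution of $x'=A(t)x+f(t,x)$ on $(n,n+1)$; (2) $\sup_{t\in\mathbb{R}}\|x(t)-y(t)\|\le\varepsilon$; (3) there exists a bounded sequence $\mathbf{z}=(z_n)_{n\in\mathbb{Z}}$ in $X$ with $\|\mathbf{z}\|_\infty'\le\varepsilon$ such that $x(n+1)=F_n(x(n))+z_{n+1}^c$ for every $n\in\mathbb{Z}$, where $F_n=U(n+1,n)$ and $U$ is the nonlinear evolution family of $x'=A(t)x+f(t,x)$.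
   Context: Let $T(t,s)$, $t,s\in\mathbb{R}$, be the linear evolution family of $x'=A(t)x$. This equation admits a partial exponential dichotomy if there are projections $P^i(s)$ on $X$ ($i\in\{1,2,3\}$, $s\in\mathbb{R}$) with $P^1(s)+P^2(s)+P^3(s)=\mathrm{Id}$ and $T(t,s)P^i(s)=P^i(t)T(t,s)$ for all $t,s\in\mathbb{R}$, and constants $D,b,d>0$ such that $\|T(t,s)P^1(s)\|\le De^{-d(t-s)}$ for $t\ge s$ and $\|T(t,s)P^2(s)\|\le De^{-b(s-t)}$ for $t\le s$. The nonlinear evolution family of $x'=A(t)x+f(t,x)$ satisfies $U(t,s)x=T(t,s)x+\int_s^tT(t,\tau)f(\tau,U(\tau,s)x)\,d\tau$ for $x\in X$, $t,s\in\mathbb{R}$ (that is, $t\mapsto U(t,s)x$ is the solution with value $x$ at time $s$). For a bounded sequence $\mathbf{z}=(z_n)_{n\in\mathbb{Z}}$ in $X$ put $z_n^c=P^3(n)z_n$, $z_n^{s,u}=z_n-z_n^c$, and $\|\mathbf{z}\|_\infty'=\max\{\sup_n\|z_n^c\|,\sup_n\|z_n^{s,u}\|\}$. *)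

theory Defs
  imports "HOL-Analysis.Analysis"
begin

definition ode_solution_on ::
    "(real \<Rightarrow> 'b::real_normed_vector \<Rightarrow> 'b) \<Rightarrow> real set \<Rightarrow> (real \<Rightarrow> 'b) \<Rightarrow> bool" where
  "ode_solution_on g S u \<longleftrightarrow> (\<forall>t\<in>S. (u has_vector_derivative g t (u t)) (at t within S))"

text \<open>
  The value at time \<open>t\<close> of the solution of \<open>u' = g(t, u)\<close> on the whole real line with
  \<open>u(s) = v\<close>. The solution exists and is unique (so the definite description is meaningful)
  when \<open>g\<close> is continuous and Lipschitz in its second argument, uniformly in time. All uses
  below are of this kind as soon as \<open>A\<close> is continuous and bounded and the perturbation is
  continuous and uniformly Lipschitz.
\<close>

definition ode_flow ::
    "(real \<Rightarrow> 'b::real_normed_vector \<Rightarrow> 'b) \<Rightarrow> real \<Rightarrow> real \<Rightarrow> 'b \<Rightarrow> 'b" where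
  "ode_flow g t s v = (THE u. ode_solution_on g UNIV u \<and> u s = v) t"

text \<open>
  The operator \<open>T(t, s)\<close> is the solution at time \<open>t\<close> of the operator-valued equation
  \<open>\<Phi>' = A(t) \<Phi>\<close> with \<open>\<Phi>(s) = Id\<close>; this makes it a bounded linear operator by typing.
\<close>

definition linear_evolution ::
    "(real \<Rightarrow> 'a::real_normed_vector \<Rightarrow>\<^sub>L 'a) \<Rightarrow> real \<Rightarrow> real \<Rightarrow> 'a \<Rightarrow>\<^sub>L 'a" where
  "linear_evolution A t s = ode_flow (\<lambda>\<tau> \<Phi>. A \<tau> o\<^sub>L \<Phi>) t s id_blinfun"

definition perturbed_field ::
    "(real \<Rightarrow> 'a::real_normed_vector \<Rightarrow>\<^sub>L 'a) \<Rightarrow> (real \<Rightarrow> 'a \<Rightarrow> 'a) \<Rightarrow> real \<Rightarrow> 'a \<Rightarrow> 'a" where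
  "perturbed_field A f t x = blinfun_apply (A t) x + f t x"

definition nonlinear_evolution ::
    "(real \<Rightarrow> 'a::real_normed_vector \<Rightarrow>\<^sub>L 'a) \<Rightarrow> (real \<Rightarrow> 'a \<Rightarrow> 'a) \<Rightarrow> real \<Rightarrow> real \<Rightarrow> 'a \<Rightarrow> 'a" where
  "nonlinear_evolution A f t s x = ode_flow (perturbed_field A f) t s x"

definition partial_exp_dichotomy ::
    "(real \<Rightarrow> 'a::real_normed_vector \<Rightarrow>\<^sub>L 'a) \<Rightarrow> (real \<Rightarrow> 'a \<Rightarrow>\<^sub>L 'a) \<Rightarrow>
     (real \<Rightarrow> 'a \<Rightarrow>\<^sub>L 'a) \<Rightarrow> (real \<Rightarrow> 'a \<Rightarrow>\<^sub>L 'a) \<Rightarrow> bool" where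
  "partial_exp_dichotomy A P1 P2 P3 \<longleftrightarrow>
     (\<forall>s. P1 s o\<^sub>L P1 s = P1 s \<and> P2 s o\<^sub>L P2 s = P2 s \<and> P3 s o\<^sub>L P3 s = P3 s) \<and>
     (\<forall>s. P1 s + P2 s + P3 s = id_blinfun) \<and>
     (\<forall>t s. linear_evolution A t s o\<^sub>L P1 s = P1 t o\<^sub>L linear_evolution A t s \<and>
            linear_evolution A t s o\<^sub>L P2 s = P2 t o\<^sub>L linear_evolution A t s \<and>
            linear_evolution A t s o\<^sub>L P3 s = P3 t o\<^sub>L linear_evolution A t s) \<and>
     (\<exists>D b d. D > 0 \<and> b > 0 \<and> d > 0 \<and>
        (\<forall>t s. t \<ge> s \<longrightarrow> norm (linear_evolution A t s o\<^sub>L P1 s) \<le> D * exp (- d * (t - s))) \<and>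
        (\<forall>t s. t \<le> s \<longrightarrow> norm (linear_evolution A t s o\<^sub>L P2 s) \<le> D * exp (- b * (s - t))))"

text \<open>
  For a partial exponential dichotomy, the bounds at \<open>t = s\<close> give \<open>norm (P1 s) \<le> D\<close> and
  \<open>norm (P2 s) \<le> D\<close>, so \<open>P3\<close> is uniformly bounded as well. Hence both suprema below are
  over bounded sets whenever \<open>z\<close> is a bounded sequence.
\<close>

definition adapted_sup_norm ::
    "(real \<Rightarrow> 'a::real_normed_vector \<Rightarrow>\<^sub>L 'a) \<Rightarrow> (int \<Rightarrow> 'a) \<Rightarrow> real" where
  "adapted_sup_norm P3 z =
     max (SUP n. norm (blinfun_apply (P3 (real_of_int n)) (z n)))
         (SUP n. norm (z n - blinfun_apply (P3 (real_of_int n)) (z n)))"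

end

theory Submission
  imports Defs "HOL-Probability.Discrete_Topology"
begin

text \<open>
  Sample the pseudo-orbit at integer times and look for \<open>x(n) = y(n) + w\<^sub>n\<close>. With
  \<open>F\<^sub>n = U(n+1, n)\<close> and \<open>g\<^sub>n(w) = F\<^sub>n(y(n) + w) - T(n+1, n) w - y(n+1)\<close>, Gronwall's inequality
  makes \<open>g\<^sub>n(0)\<close> of order \<open>\<delta>\<close> and the Lipschitz constant of \<open>g\<^sub>n\<close> of order \<open>c\<close>. The equation
  \<open>w\<^sub>n\<^sub>+\<^sub>1 = T(n+1, n) w\<^sub>n + (P\<^sup>1 + P\<^sup>2)(n+1) g\<^sub>n(w\<^sub>n)\<close> is inverted by the Green operator of the
  dichotomy, which is bounded on bounded sequences, so for small \<open>c\<close> the contraction principle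
  yields a solution of size \<open>O(\<delta>)\<close>. The omitted central component \<open>- P\<^sup>3(n+1) g\<^sub>n(w\<^sub>n)\<close> is
  \<open>z\<^sub>n\<^sub>+\<^sub>1\<close>.
\<close>

section \<open>Gronwall-type estimates\<close>

text \<open>The right-hand side has derivative \<open>K * B * exp (2 * K * (t - s))\<close>, so the
  mean value inequality applies. The halved constant is what later makes the Picard operator a
  contraction.\<close>

lemma norm_le_exp_of_derivative_bound_forward:
  fixes H :: "real \<Rightarrow> 'b::real_normed_vector"
  assumes H: "\<And>t. (H has_vector_derivative h t) (at t)"
    and h: "\<And>t. s \<le> t \<Longrightarrow> norm (h t) \<le> K * B * exp (2 * K * (t - s))"
    and "H s = 0" and "s \<le> t" and "0 \<le> B"
  shows "norm (H t) \<le> B / 2 * exp (2 * K * (t - s))"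
proof (cases "s = t")
  case False
  have "norm (H t - H s) \<le> B / 2 * exp (2 * K * (t - s)) - B / 2 * exp (2 * K * (s - s))"
  proof (rule differentiable_bound_general[where f' = h])
    show "continuous_on {s..t} H"
      using H by (intro continuous_at_imp_continuous_on)
        (auto intro: has_vector_derivative_continuous)
    show "((\<lambda>t. B / 2 * exp (2 * K * (t - s))) has_vector_derivative
        K * B * exp (2 * K * (x - s))) (at x)" if "s < x" "x < t" for x
      by (auto intro!: derivative_eq_intros
          simp flip: has_real_derivative_iff_has_vector_derivative)
  qed (use False assms in \<open>auto intro!: continuous_intros\<close>)
  with assms show ?thesis by simp
qed (use assms in auto)

text \<open>For \<open>t < s\<close> the forward estimate is applied to the time reversal
  \<open>H \<circ> uminus\<close>.\<close>

lemma norm_le_exp_of_derivative_bound: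
  fixes H :: "real \<Rightarrow> 'b::real_normed_vector"
  assumes H: "\<And>t. (H has_vector_derivative h t) (at t)"
    and h: "\<And>t. norm (h t) \<le> K * B * exp (2 * K * \<bar>t - s\<bar>)"
    and "H s = 0" and "0 \<le> B"
  shows "norm (H t) \<le> B / 2 * exp (2 * K * \<bar>t - s\<bar>)"
proof (cases "s \<le> t")
  case True
  have "norm (H t) \<le> B / 2 * exp (2 * K * (t - s))"
    by (rule norm_le_exp_of_derivative_bound_forward[where h = h])
      (use True assms in \<open>auto intro: order_trans[OF h]\<close>)
  with True show ?thesis by simp
next
  case False
  have "norm ((H \<circ> uminus) (- t)) \<le> B / 2 * exp (2 * K * (- t - - s))"
  proof (rule norm_le_exp_of_derivative_bound_forward)
    show "(H \<circ> uminus has_vector_derivative - 1 *\<^sub>R h (- \<tau>)) (at \<tau>)" for \<tau>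
      by (rule vector_diff_chain_at) (auto intro!: derivative_eq_intros H)
    show "norm (- 1 *\<^sub>R h (- \<tau>)) \<le> K * B * exp (2 * K * (\<tau> - - s))" if "- s \<le> \<tau>" for \<tau>
    proof -
      have "\<bar>- \<tau> - s\<bar> = \<tau> - - s" using that by simp
      with h[of "- \<tau>"] show ?thesis by simp
    qed
  qed (use False assms in auto)
  with False show ?thesis by simp
qed

text \<open>A pseudo-orbit may have a discontinuous derivative, so the estimate runs through the
  mean value inequality rather than through integrals of \<open>r'\<close>. The factor 2 and the
  doubled rate \<open>2 * K\<close> are the price.\<close>

lemma gronwall_bound:
  fixes r :: "real \<Rightarrow> 'b::real_normed_vector"
  assumes "a \<le> t" and "0 < K" and "0 \<le> \<delta>"
    and r: "\<And>\<tau>. (r has_vector_derivative r' \<tau>) (at \<tau>)"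
    and r': "\<And>\<tau>. a \<le> \<tau> \<Longrightarrow> \<tau> \<le> t \<Longrightarrow> norm (r' \<tau>) \<le> K * norm (r \<tau>) + \<delta>"
  shows "norm (r t) \<le> 2 * (norm (r a) + \<delta> * (t - a)) * exp (2 * K * (t - a))"
proof -
  \<comment> \<open>Integrating the bound at a maximum point of the weighted norm \<open>m\<close> lets half of that maximum
    be absorbed.\<close>
  define m where "m \<tau> = exp (- (2 * K * (\<tau> - a))) * norm (r \<tau>)" for \<tau>
  have cr: "continuous_on S r" for S
    using r by (intro continuous_at_imp_continuous_on)
        (auto intro: has_vector_derivative_continuous)
  have "continuous_on {a..t} m"
    unfolding m_def by (intro continuous_intros cr)
  then obtain \<sigma> where \<sigma>: "\<sigma> \<in> {a..t}" and max: "\<And>\<tau>. \<tau> \<in> {a..t} \<Longrightarrow> m \<tau> \<le> m \<sigma>"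
    using continuous_attains_sup[of "{a..t}" m] \<open>a \<le> t\<close> by auto
  have r_eq: "norm (r \<tau>) = m \<tau> * exp (2 * K * (\<tau> - a))" for \<tau>
    by (simp add: m_def exp_minus)
  have r_le: "norm (r \<tau>) \<le> m \<sigma> * exp (2 * K * (\<tau> - a))" if "\<tau> \<in> {a..t}" for \<tau>
    unfolding r_eq[of \<tau>] using max[OF that] by (intro mult_right_mono) auto
  have "norm (r \<sigma> - r a) \<le> (m \<sigma> / 2 * exp (2 * K * (\<sigma> - a)) + \<delta> * \<sigma>)
      - (m \<sigma> / 2 * exp (2 * K * (a - a)) + \<delta> * a)"
  proof (cases "a = \<sigma>")
    case False
    show ?thesis
    proof (rule differentiable_bound_general[where f' = r'])
      show "((\<lambda>\<tau>. m \<sigma> / 2 * exp (2 * K * (\<tau> - a)) + \<delta> * \<tau>) has_vector_derivative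
          K * (m \<sigma> * exp (2 * K * (x - a))) + \<delta>) (at x)" for x
        by (auto intro!: derivative_eq_intros
            simp flip: has_real_derivative_iff_has_vector_derivative)
      show "norm (r' x) \<le> K * (m \<sigma> * exp (2 * K * (x - a))) + \<delta>" if "a < x" "x < \<sigma>" for x
        using r'[of x] r_le[of x] that \<sigma> \<open>0 < K\<close>
        by (smt (verit) atLeastAtMost_iff mult_left_mono)
    qed (use False \<sigma> r in \<open>auto intro!: continuous_intros cr\<close>)
  qed auto
  moreover note r_eq[of \<sigma>]
  moreover have "norm (r \<sigma>) \<le> norm (r a) + norm (r \<sigma> - r a)"
    by (metis add.commute norm_triangle_sub)
  moreover have "0 \<le> m \<sigma>" by (simp add: m_def)
  moreover have "\<delta> * (\<sigma> - a) \<le> \<delta> * (t - a)"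
    using \<sigma> \<open>0 \<le> \<delta>\<close> by (intro mult_left_mono) auto
  moreover have "m \<sigma> \<le> m \<sigma> * exp (2 * K * (\<sigma> - a))"
    using \<sigma> \<open>0 < K\<close> \<open>0 \<le> m \<sigma>\<close> by (simp add: mult_le_cancel_left1)
  ultimately have "m \<sigma> \<le> 2 * (norm (r a) + \<delta> * (t - a))"
    by (simp add: algebra_simps)
  then have "m \<sigma> * exp (2 * K * (t - a)) \<le> 2 * (norm (r a) + \<delta> * (t - a)) * exp (2 * K * (t - a))"
    by (intro mult_right_mono) auto
  moreover have "norm (r t) \<le> m \<sigma> * exp (2 * K * (t - a))"
    using r_le[of t] \<open>a \<le> t\<close> by simp
  ultimately show ?thesis by (rule order_trans[rotated])
qed

text \<open>This is \<open>gronwall_bound\<close> with \<open>\<delta> = 0\<close>, used forwards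
  and, after time reversal, backwards. Applied to the difference of two solutions it gives
  uniqueness on the whole line.\<close>

lemma zero_of_derivative_bound:
  fixes r :: "real \<Rightarrow> 'b::real_normed_vector"
  assumes "0 < K" and "r s = 0"
    and r: "\<And>\<tau>. (r has_vector_derivative r' \<tau>) (at \<tau>)"
    and r': "\<And>\<tau>. norm (r' \<tau>) \<le> K * norm (r \<tau>)"
  shows "r t = 0"
proof (cases "s \<le> t")
  case True
  have "norm (r t) \<le> 2 * (norm (r s) + 0 * (t - s)) * exp (2 * K * (t - s))"
    by (rule gronwall_bound) (use True assms in auto)
  with assms show ?thesis by simp
next
  case False
  have "norm ((r \<circ> uminus) (- t)) \<le>
      2 * (norm ((r \<circ> uminus) (- s)) + 0 * (- t - - s)) * exp (2 * K * (- t - - s))"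
  proof (rule gronwall_bound)
    show "(r \<circ> uminus has_vector_derivative - 1 *\<^sub>R r' (- \<tau>)) (at \<tau>)" for \<tau>
      by (rule vector_diff_chain_at) (auto intro!: derivative_eq_intros r)
  qed (use False assms in auto)
  with assms show ?thesis by simp
qed

section \<open>Global flows of Lipschitz fields\<close>

text \<open>\<open>H\<close> is the oriented integral from \<open>s\<close> to \<open>t\<close>: at
  least one of the two intervals is empty or a single point and contributes nothing.\<close>

lemma antiderivative_on_line:
  fixes h :: "real \<Rightarrow> 'b::banach"
  assumes h: "continuous_on UNIV h"
  fixes s :: real
  defines "H \<equiv> \<lambda>t. integral {s..t} h - integral {t..s} h"
  shows "(H has_vector_derivative h t) (at t)" and "H s = 0"
proof -
  \<comment> \<open>With a base point \<open>a\<close> to the left of both \<open>s\<close> and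
    \<open>t\<close>, \<open>H\<close> is near \<open>t\<close> a single integral with moving upper
    end, up to a constant. The margins of 1 keep \<open>t\<close> in the interior.\<close>
  define a b where "a = min s t - 1" and "b = max s t + 1"
  have int: "h integrable_on {x..y}" for x y
    by (rule integrable_continuous_interval) (rule continuous_on_subset[OF h], simp)
  have H_eq: "H x = integral {a..x} h - integral {a..s} h" if "x \<in> {a<..<b}" for x
  proof (cases "s \<le> x")
    case True
    have "integral {a..s} h + integral {s..x} h = integral {a..x} h"
      by (rule Henstock_Kurzweil_Integration.integral_combine) (use True in \<open>auto simp: a_def intro: int\<close>)
    moreover have "integral {x..s} h = 0"
      using True by (cases "s = x") auto
    ultimately show ?thesis unfolding H_def by (simp add: algebra_simps)
  next
    case False
    have "integral {a..x} h + integral {x..s} h = integral {a..s} h"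
      by (rule Henstock_Kurzweil_Integration.integral_combine) (use False that in \<open>auto intro: int\<close>)
    then show ?thesis using False unfolding H_def by (simp add: algebra_simps)
  qed
  have "((\<lambda>x. integral {a..x} h) has_vector_derivative h t) (at t within {a..b})"
    by (rule integral_has_vector_derivative)
      (auto simp: a_def b_def intro: continuous_on_subset[OF h])
  then have "((\<lambda>x. integral {a..x} h) has_vector_derivative h t) (at t within {a<..<b})"
    by (rule has_vector_derivative_within_subset) auto
  then have "((\<lambda>x. integral {a..x} h) has_vector_derivative h t) (at t)"
    by (subst (asm) at_within_open) (auto simp: a_def b_def)
  then have "((\<lambda>x. integral {a..x} h - integral {a..s} h) has_vector_derivative h t) (at t)"
    by (auto intro!: derivative_eq_intros)
  then show "(H has_vector_derivative h t) (at t)"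
    by (rule has_vector_derivative_transform_within_open[where S = "{a<..<b}"])
      (auto simp: H_eq, auto simp: a_def b_def)
  show "H s = 0" by (simp add: H_def)
qed


text \<open>Serves both the operator equation behind \<open>T\<close> and the perturbed equation
  behind \<open>U\<close>. Together with the Lipschitz bound, \<open>field_zero\<close> gives linear
  growth, which keeps Picard iterates in the weighted space.\<close>

locale lipschitz_field =
  fixes g :: "real \<Rightarrow> 'b::banach \<Rightarrow> 'b" and K :: real
  assumes continuous_field: "continuous_on UNIV (\<lambda>(t, x). g t x)"
    and field_zero: "g t 0 = 0"
    and lipschitz: "norm (g t x - g t y) \<le> K * norm (x - y)"
    and K_pos: "0 < K"
begin

lemma ode_solution_unique:
  assumes "ode_solution_on g UNIV u" and "ode_solution_on g UNIV v" and "u s = v s"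
  shows "u = v"
proof
  fix t
  have "u t - v t = 0"
  proof (rule zero_of_derivative_bound[where r = "\<lambda>t. u t - v t" and s = s])
    show "((\<lambda>t. u t - v t) has_vector_derivative g \<tau> (u \<tau>) - g \<tau> (v \<tau>)) (at \<tau>)" for \<tau>
      using assms unfolding ode_solution_on_def by (auto intro!: derivative_eq_intros)
  qed (use assms K_pos lipschitz in auto)
  then show "u t = v t" by simp
qed

text \<open>The weight \<open>exp (- 2 * K * \<bar>t - s\<bar>)\<close> turns the Picard operator on the whole line into a
  contraction with constant \<open>1/2\<close> of the bounded continuous functions.\<close>

lemma ode_solution_exists:
  fixes s :: real and v :: 'b
  shows "\<exists>u. ode_solution_on g UNIV u \<and> u s = v"
proof -
  define e where "e t = exp (2 * K * \<bar>t - s\<bar>)" for t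
  have e_pos: "0 < e t" for t by (simp add: e_def)
  have cont_e: "continuous_on S e" for S
    unfolding e_def by (intro continuous_intros)
  \<comment> \<open>A bounded function \<open>p\<close> stands for the candidate solution
    \<open>e * p\<close>. \<open>h p\<close> is the field along that candidate, and
    \<open>\<Phi> p\<close> below is its Picard image divided by the weight.\<close>
  define h where "h p \<tau> = g \<tau> (e \<tau> *\<^sub>R apply_bcontfun p \<tau>)" for p \<tau>
  have cont_h: "continuous_on UNIV (h p)" for p
  proof -
    have "continuous_on UNIV ((\<lambda>(t, x). g t x) \<circ> (\<lambda>\<tau>. (\<tau>, e \<tau> *\<^sub>R apply_bcontfun p \<tau>)))"
      by (intro continuous_on_compose continuous_intros cont_e continuous_on_subset[OF continuous_field])
        auto
    then show ?thesis by (simp add: h_def[abs_def] o_def)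
  qed
  define H where "H p t = integral {s..t} (h p) - integral {t..s} (h p)" for p t
  have H: "(H p has_vector_derivative h p t) (at t)" "H p s = 0" for p t
    unfolding H_def[abs_def]
    using antiderivative_on_line[OF cont_h[of p], of s] by auto
  have H_diff: "norm (H p t - H q t) \<le> dist p q / 2 * e t" for p q t
    unfolding e_def
  proof (rule norm_le_exp_of_derivative_bound)
    show "((\<lambda>t. H p t - H q t) has_vector_derivative h p \<tau> - h q \<tau>) (at \<tau>)" for \<tau>
      by (auto intro!: derivative_eq_intros H)
    show "norm (h p \<tau> - h q \<tau>) \<le> K * dist p q * exp (2 * K * \<bar>\<tau> - s\<bar>)" for \<tau>
    proof -
      have "norm (h p \<tau> - h q \<tau>) \<le> K * norm (e \<tau> *\<^sub>R (apply_bcontfun p \<tau> - apply_bcontfun q \<tau>))"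
        unfolding h_def scaleR_right_diff_distrib by (rule lipschitz)
      also have "\<dots> = K * norm (apply_bcontfun p \<tau> - apply_bcontfun q \<tau>) * e \<tau>"
        using e_pos[of \<tau>] by simp
      also have "\<dots> \<le> K * dist p q * e \<tau>"
        using dist_bounded[of p \<tau> q] K_pos e_pos[of \<tau>]
        by (intro mult_right_mono mult_left_mono) (auto simp: dist_norm)
      finally show ?thesis by (simp add: e_def)
    qed
  qed (use H in auto)
  \<comment> \<open>Hence \<open>H_diff\<close> with \<open>q = 0\<close> bounds \<open>H p\<close>
    itself, which shows that \<open>\<Phi> p\<close> is bounded.\<close>
  have H_zero: "H 0 t = 0" for t
    by (simp add: H_def h_def[abs_def] field_zero)
  define \<Phi> where "\<Phi> p t = inverse (e t) *\<^sub>R (v + H p t)" for p t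
  have "\<Phi> p \<in> bcontfun" for p
  proof -
    have "continuous_on UNIV (H p)"
      using H by (intro continuous_at_imp_continuous_on)
        (auto intro: has_vector_derivative_continuous)
    then have "continuous_on UNIV (\<Phi> p)"
      unfolding \<Phi>_def[abs_def] using e_pos
      by (intro continuous_intros cont_e) (auto simp: less_imp_neq[symmetric])
    moreover have "norm (\<Phi> p t) \<le> norm v + dist p 0 / 2" for t
    proof -
      have "norm (v + H p t) \<le> norm v + dist p 0 / 2 * e t"
        using norm_triangle_ineq[of v "H p t"] H_diff[of p t 0] by (simp add: H_zero)
      also have "\<dots> \<le> norm v * e t + dist p 0 / 2 * e t"
        using K_pos by (simp add: e_def mult_le_cancel_left1)
      finally have "inverse (e t) * norm (v + H p t) \<le> norm v + dist p 0 / 2"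
        using e_pos[of t] by (simp add: field_simps)
      then show ?thesis
        using e_pos[of t] by (simp add: \<Phi>_def)
    qed
    ultimately show ?thesis
      by (auto simp: bcontfun_def bounded_iff)
  qed
  then have app: "apply_bcontfun (Bcontfun (\<Phi> p)) = \<Phi> p" for p
    by (rule Bcontfun_inverse)
  have "\<exists>!p. Bcontfun (\<Phi> p) = p"
  proof (rule banach_fix_type[where c = "1/2"])
    show "\<forall>p q. dist (Bcontfun (\<Phi> p)) (Bcontfun (\<Phi> q)) \<le> 1/2 * dist p q"
    proof (intro allI dist_bound)
      fix p q t
      have "dist (\<Phi> p t) (\<Phi> q t) = norm (inverse (e t) *\<^sub>R (H p t - H q t))"
        unfolding \<Phi>_def dist_norm by (simp add: algebra_simps)
      also have "\<dots> = inverse (e t) * norm (H p t - H q t)"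
        using e_pos[of t] by simp
      also have "\<dots> \<le> 1/2 * dist p q"
        using H_diff[of p t q] e_pos[of t] by (simp add: field_simps)
      finally show "dist (apply_bcontfun (Bcontfun (\<Phi> p)) t) (apply_bcontfun (Bcontfun (\<Phi> q)) t)
          \<le> 1/2 * dist p q"
        by (simp add: app)
    qed
  qed auto
  then obtain p where p: "apply_bcontfun p = \<Phi> p"
    by (metis app)
  define u where "u t = v + H p t" for t
  have u: "u t = e t *\<^sub>R apply_bcontfun p t" for t
    using e_pos[of t] by (simp add: p \<Phi>_def u_def)
  have "ode_solution_on g UNIV u"
    unfolding ode_solution_on_def
  proof
    fix t
    have "(u has_vector_derivative h p t) (at t)"
      unfolding u_def[abs_def] by (auto intro!: derivative_eq_intros H)
    then show "(u has_vector_derivative g t (u t)) (at t within UNIV)"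
      by (simp add: h_def u)
  qed
  moreover have "u s = v" by (simp add: u_def H)
  ultimately show ?thesis by blast
qed

lemma ode_flow_eq:
  assumes "ode_solution_on g UNIV u"
  shows "ode_flow g t s (u s) = u t"
proof -
  have "(THE w. ode_solution_on g UNIV w \<and> w s = u s) = u"
    using assms by (intro the_equality) (auto intro: ode_solution_unique)
  then show ?thesis by (simp add: ode_flow_def)
qed

lemma ode_flow_initial [simp]: "ode_flow g s s v = v"
  using ode_solution_exists[of s v] ode_flow_eq by metis

lemma ode_flow_derivative:
  "((\<lambda>t. ode_flow g t s v) has_vector_derivative g t (ode_flow g t s v)) (at t)"
proof -
  obtain u where u: "ode_solution_on g UNIV u" "u s = v"
    using ode_solution_exists by blast
  then have "ode_flow g t s v = u t" for t
    using ode_flow_eq by blast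
  with u show ?thesis by (simp add: ode_solution_on_def)
qed

end


section \<open>Geometric series and the linear evolution family\<close>

lemma norm_suminf_le_geometric:
  fixes G :: "nat \<Rightarrow> 'b::banach"
  assumes G: "\<And>k. norm (G k) \<le> C * q ^ k" and q: "0 \<le> q" "q < 1"
  shows "summable G" and "norm (suminf G) \<le> C / (1 - q)"
proof -
  have sum: "summable (\<lambda>k. C * q ^ k)"
    using q by (intro summable_mult summable_geometric) auto
  show "summable G"
    using sum G by (rule summable_comparison_test'[where N = 0])
  have "norm (suminf G) \<le> (\<Sum>k. C * q ^ k)"
    by (rule norm_suminf_le[OF G sum])
  also have "\<dots> = C * (\<Sum>k. q ^ k)"
    by (rule suminf_mult) (use q in \<open>auto intro: summable_geometric\<close>)
  also have "\<dots> = C / (1 - q)"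
    using q by (subst suminf_geometric) auto
  finally show "norm (suminf G) \<le> C / (1 - q)" .
qed

lemma blinfun_compose_assoc: "(f o\<^sub>L g) o\<^sub>L h = f o\<^sub>L (g o\<^sub>L h)"
  by (rule blinfun_eqI) simp

lemma id_blinfun_compose [simp]: "id_blinfun o\<^sub>L f = f"
  by (rule blinfun_eqI) simp

locale bounded_linear_ode =
  fixes A :: "real \<Rightarrow> 'a::banach \<Rightarrow>\<^sub>L 'a" and N :: real
  assumes continuous_A: "continuous_on UNIV A"
    and norm_A: "norm (A t) \<le> N"
    and N_pos: "0 < N"
begin

abbreviation T :: "real \<Rightarrow> real \<Rightarrow> 'a \<Rightarrow>\<^sub>L 'a" where
  "T \<equiv> linear_evolution A"

lemma norm_A_apply: "norm (blinfun_apply (A t) x) \<le> N * norm x"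
  by (meson mult_right_mono norm_A norm_blinfun norm_ge_zero order_trans)

lemma continuous_A_fst: "continuous_on UNIV (\<lambda>p :: real \<times> 'b::topological_space. A (fst p))"
  by (rule continuous_on_compose2[OF continuous_A continuous_on_fst[OF continuous_on_id]]) auto

sublocale operator_ode: lipschitz_field "\<lambda>\<tau> (\<Phi> :: 'a \<Rightarrow>\<^sub>L 'a). A \<tau> o\<^sub>L \<Phi>" N
proof
  show "continuous_on UNIV (\<lambda>(t, \<Phi>). A t o\<^sub>L \<Phi>)"
    unfolding case_prod_beta
    by (intro bounded_bilinear.continuous_on[OF bounded_bilinear_blinfun_compose]
        continuous_A_fst continuous_intros)
  show "norm ((A t o\<^sub>L x) - (A t o\<^sub>L y)) \<le> N * norm (x - y)" for t and x y :: "'a \<Rightarrow>\<^sub>L 'a"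
  proof -
    have "norm (A t o\<^sub>L (x - y)) \<le> N * norm (x - y)"
      by (meson mult_right_mono norm_A norm_blinfun_compose norm_ge_zero order_trans)
    then show ?thesis
      by (simp add: bounded_bilinear.diff_right[OF bounded_bilinear_blinfun_compose])
  qed
qed (use N_pos in auto)

lemma T_initial [simp]: "T s s = id_blinfun"
  by (simp add: linear_evolution_def)

lemma T_derivative: "((\<lambda>t. T t s) has_vector_derivative A t o\<^sub>L T t s) (at t)"
  unfolding linear_evolution_def by (rule operator_ode.ode_flow_derivative)

lemma T_apply_derivative:
  "((\<lambda>t. blinfun_apply (T t s) x) has_vector_derivative A t (T t s x)) (at t)"
  using bounded_linear.has_vector_derivative[OF blinfun.bounded_linear_left T_derivative]
  by simp

text \<open>As functions of \<open>t\<close>, both sides solve the operator equation, and they agree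
  at \<open>t = s\<close>; uniqueness does the rest.\<close>

lemma T_compose: "T t s o\<^sub>L T s r = T t r"
proof -
  have "ode_solution_on (\<lambda>\<tau> \<Phi>. A \<tau> o\<^sub>L \<Phi>) UNIV (\<lambda>t. T t s o\<^sub>L T s r)"
    unfolding ode_solution_on_def
  proof
    fix t
    have "((\<lambda>t. T t s o\<^sub>L T s r) has_vector_derivative (A t o\<^sub>L T t s) o\<^sub>L T s r) (at t)"
      by (rule bounded_linear.has_vector_derivative[OF bounded_bilinear.bounded_linear_left[OF
            bounded_bilinear_blinfun_compose] T_derivative])
    then show "((\<lambda>t. T t s o\<^sub>L T s r) has_vector_derivative A t o\<^sub>L (T t s o\<^sub>L T s r)) (at t within UNIV)"
      by (simp add: blinfun_compose_assoc)
  qed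
  moreover have "ode_solution_on (\<lambda>\<tau> \<Phi>. A \<tau> o\<^sub>L \<Phi>) UNIV (\<lambda>t. T t r)"
    by (simp add: ode_solution_on_def T_derivative)
  ultimately have "(\<lambda>t. T t s o\<^sub>L T s r) = (\<lambda>t. T t r)"
    by (rule operator_ode.ode_solution_unique[where s = s]) simp
  then show ?thesis by metis
qed

lemma T_T_apply: "T t s (T s r x) = T t r x"
  by (simp flip: T_compose[of t s r])

end

section \<open>The Green operator of the dichotomy\<close>

locale dichotomous_ode = bounded_linear_ode A N
  for A :: "real \<Rightarrow> 'a::banach \<Rightarrow>\<^sub>L 'a" and N :: real +
  fixes P1 P2 P3 :: "real \<Rightarrow> 'a \<Rightarrow>\<^sub>L 'a" and D b d :: real
  assumes P_sum: "P1 s + P2 s + P3 s = id_blinfun"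
    and D_pos: "0 < D" and b_pos: "0 < b" and d_pos: "0 < d"
    and stable: "s \<le> t \<Longrightarrow> norm (T t s o\<^sub>L P1 s) \<le> D * exp (- d * (t - s))"
    and unstable: "t \<le> s \<Longrightarrow> norm (T t s o\<^sub>L P2 s) \<le> D * exp (- b * (s - t))"
begin

lemma norm_P3_le: "norm (P3 s) \<le> 1 + 2 * D"
proof -
  have "norm (P1 s) \<le> D" "norm (P2 s) \<le> D"
    using stable[of s s] unstable[of s s] by simp_all
  moreover have "P3 s = id_blinfun - P1 s - P2 s"
    by (simp flip: P_sum[of s])
  moreover have "norm (id_blinfun :: 'a \<Rightarrow>\<^sub>L 'a) \<le> 1"
    by (rule norm_blinfun_id_le)
  ultimately show ?thesis
    using norm_triangle_ineq4[of "id_blinfun - P1 s" "P2 s"]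
      norm_triangle_ineq4[of "id_blinfun" "P1 s"] by simp
qed

text \<open>Inputs at times up to \<open>n\<close> are carried forward to \<open>n\<close> along
  \<open>P1\<close>, later inputs back to \<open>n\<close> along \<open>P2\<close>. The input at
  time \<open>n\<close> itself enters only the stable sum, hence the shift by 1 in
  \<open>unstable_term\<close>.\<close>

definition stable_term :: "(int \<Rightarrow> 'a) \<Rightarrow> int \<Rightarrow> nat \<Rightarrow> 'a" where
  "stable_term h n k = T n (n - int k) (P1 (n - int k) (h (n - int k)))"

definition unstable_term :: "(int \<Rightarrow> 'a) \<Rightarrow> int \<Rightarrow> nat \<Rightarrow> 'a" where
  "unstable_term h n k = T n (n + int k + 1) (P2 (n + int k + 1) (h (n + int k + 1)))"

text \<open>Solution operator on bounded inputs of w(n+1) = T(n+1, n) w(n) + (P1 + P2)(n+1) h(n+1).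
  The minus sign arises because the unstable part is solved backwards in time.\<close>

definition green :: "(int \<Rightarrow> 'a) \<Rightarrow> int \<Rightarrow> 'a" where
  "green h n = suminf (stable_term h n) - suminf (unstable_term h n)"

text \<open>An upper bound for the operator norm of \<open>green\<close> in the supremum norm,
  obtained from the geometric series with ratios \<open>exp (- d)\<close> and
  \<open>exp (- b)\<close>.\<close>

definition green_norm :: real where
  "green_norm = D / (1 - exp (- d)) + D / (1 - exp (- b))"

lemma green_norm_pos: "0 < green_norm"
  using D_pos b_pos d_pos by (simp add: green_norm_def add_pos_pos)

lemma stable_term_le:
  assumes "\<And>n. norm (h n) \<le> B"
  shows "norm (stable_term h n k) \<le> (D * B) * exp (- d) ^ k"
proof -
  let ?m = "n - int k"
  have "norm (stable_term h n k) \<le> norm (T n ?m o\<^sub>L P1 ?m) * norm (h ?m)"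
    using norm_blinfun[of "T n ?m o\<^sub>L P1 ?m" "h ?m"] by (simp add: stable_term_def)
  also have "\<dots> \<le> (D * exp (- d * (real_of_int n - real_of_int ?m))) * B"
    using D_pos by (intro mult_mono stable assms) auto
  finally show ?thesis by (simp add: mult_ac flip: exp_of_nat_mult)
qed

lemma unstable_term_le:
  assumes "\<And>n. norm (h n) \<le> B"
  shows "norm (unstable_term h n k) \<le> (D * B) * exp (- b) ^ k"
proof -
  let ?m = "n + int k + 1"
  have B: "0 \<le> B" using order_trans[OF norm_ge_zero assms] .
  have "norm (unstable_term h n k) \<le> norm (T n ?m o\<^sub>L P2 ?m) * norm (h ?m)"
    using norm_blinfun[of "T n ?m o\<^sub>L P2 ?m" "h ?m"] by (simp add: unstable_term_def)
  also have "\<dots> \<le> (D * exp (- b * (real_of_int ?m - real_of_int n))) * B"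
    using D_pos by (intro mult_mono unstable assms) auto
  \<comment> \<open>The exponent actually contains \<open>k + 1\<close>; giving up a factor
    \<open>exp (- b)\<close> leaves a plain power \<open>q ^ k\<close>.\<close>
  also have "\<dots> \<le> (D * exp (- b * real k)) * B"
    using D_pos b_pos B by (intro mult_right_mono mult_left_mono) auto
  finally show ?thesis by (simp add: mult_ac flip: exp_of_nat_mult)
qed

lemma
  assumes "\<And>n. norm (h n) \<le> B"
  shows summable_stable: "summable (stable_term h n)"
    and summable_unstable: "summable (unstable_term h n)"
    and norm_green_le: "norm (green h n) \<le> green_norm * B"
proof -
  note 1 = norm_suminf_le_geometric[OF stable_term_le[of h, OF assms, of n]]
  note 2 = norm_suminf_le_geometric[OF unstable_term_le[of h, OF assms, of n]]
  show "summable (stable_term h n)" "summable (unstable_term h n)"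
    using d_pos b_pos by (auto intro: 1 2)
  have "norm (green h n) \<le> D * B / (1 - exp (- d)) + D * B / (1 - exp (- b))"
    unfolding green_def using d_pos b_pos
    by (intro order_trans[OF norm_triangle_ineq4] add_mono 1 2) auto
  then show "norm (green h n) \<le> green_norm * B"
    by (simp add: green_norm_def algebra_simps)
qed

text \<open>Both sequences are bounded so that all four series converge and may be subtracted
  termwise. This turns \<open>norm_green_le\<close> into a Lipschitz estimate.\<close>

lemma green_diff:
  assumes g: "\<And>n. norm (g n) \<le> B" and h: "\<And>n. norm (h n) \<le> C"
  shows "green g n - green h n = green (\<lambda>n. g n - h n) n"
proof -
  have "stable_term (\<lambda>n. g n - h n) n = (\<lambda>k. stable_term g n k - stable_term h n k)"
    and "unstable_term (\<lambda>n. g n - h n) n = (\<lambda>k. unstable_term g n k - unstable_term h n k)"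
    by (auto simp: stable_term_def unstable_term_def blinfun.diff_right)
  then show ?thesis
    using suminf_diff[OF summable_stable[of g, OF g] summable_stable[of h, OF h], of n n]
      suminf_diff[OF summable_unstable[of g, OF g] summable_unstable[of h, OF h], of n n]
    by (simp add: green_def algebra_simps)
qed

text \<open>Applying T(n+1, n) shifts the index in both series: the stable sum at
  \<open>n + 1\<close> gains a new head \<open>P1 (n + 1) (h (n + 1))\<close>, and the unstable sum
  loses its head \<open>P2 (n + 1) (h (n + 1))\<close>. Since the unstable sum is subtracted, both
  heads appear with a plus sign, and \<open>P_sum\<close> rewrites their sum.\<close>

lemma green_step:
  assumes "\<And>n. norm (h n) \<le> B"
  shows "green h (n + 1) = T (n + 1) n (green h n) + h (n + 1) - P3 (n + 1) (h (n + 1))"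
proof -
  let ?T = "blinfun_apply (T (real_of_int n + 1) (real_of_int n))"
  note sums = summable_stable[of h, OF assms] summable_unstable[of h, OF assms]
  have T_suminf: "?T (suminf v) = (\<Sum>k. ?T (v k))" if "summable v" for v
    using bounded_linear.suminf[OF blinfun.bounded_linear_right that, of "T (n + 1) n"] by simp
  have "suminf (stable_term h (n + 1)) =
      stable_term h (n + 1) 0 + (\<Sum>k. stable_term h (n + 1) (Suc k))"
    using suminf_split_head[OF sums(1), of "n + 1"] by simp
  also have "(\<lambda>k. stable_term h (n + 1) (Suc k)) = (\<lambda>k. ?T (stable_term h n k))"
    by (simp add: stable_term_def T_T_apply)
  finally have 1: "suminf (stable_term h (n + 1)) =
      P1 (n + 1) (h (n + 1)) + ?T (suminf (stable_term h n))"
    by (simp add: T_suminf[OF sums(1)]) (simp add: stable_term_def)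
  have "?T (suminf (unstable_term h n)) = (\<Sum>k. ?T (unstable_term h n k))"
    using T_suminf[OF sums(2)] by simp
  also have "\<dots> = ?T (unstable_term h n 0) + (\<Sum>k. ?T (unstable_term h n (Suc k)))"
    using suminf_split_head[OF bounded_linear.summable[OF blinfun.bounded_linear_right sums(2)],
        of "T (n + 1) n" n] by simp
  also have "(\<lambda>k. ?T (unstable_term h n (Suc k))) = unstable_term h (n + 1)"
    by (simp add: unstable_term_def[abs_def] T_T_apply add_ac)
  finally have 2: "?T (suminf (unstable_term h n)) =
      P2 (n + 1) (h (n + 1)) + suminf (unstable_term h (n + 1))"
    unfolding unstable_term_def[of h n 0] by (simp add: T_T_apply)
  have "h (n + 1) = (P1 (n + 1) + P2 (n + 1) + P3 (n + 1)) (h (n + 1))"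
    by (simp only: P_sum) simp
  then have "h (n + 1) - P3 (n + 1) (h (n + 1)) = P1 (n + 1) (h (n + 1)) + P2 (n + 1) (h (n + 1))"
    by (simp add: blinfun.add_left algebra_simps)
  with 1 2 show ?thesis
    unfolding green_def by (simp add: blinfun.diff_right algebra_simps)
qed

text \<open>The map sending \<open>p\<close> to \<open>green (h p)\<close> is a contraction with
  constant \<open>green_norm * \<kappa>\<close>, hence with constant 1/2. It moves 0 by at most
  \<open>green_norm * \<eta>\<close>, so its fixed point has at most twice that norm.\<close>

lemma green_fixpoint:
  fixes g :: "int \<Rightarrow> 'a \<Rightarrow> 'a"
  assumes g0: "\<And>n. norm (g n 0) \<le> \<eta>"
    and lip: "\<And>n x y. norm (g n x - g n y) \<le> \<kappa> * norm (x - y)"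
    and "0 \<le> \<kappa>" and small: "green_norm * \<kappa> \<le> 1 / 2"
  obtains w where "\<And>n. norm (w n) \<le> 2 * green_norm * \<eta>"
    and "\<And>n. w (n + 1) = T (real_of_int (n + 1)) (real_of_int n) (w n)
      + g n (w n) - P3 (real_of_int (n + 1)) (g n (w n))"
proof -
  \<comment> \<open>\<open>green_step\<close> feeds in the input at time \<open>n + 1\<close> when
    passing from \<open>n\<close> to \<open>n + 1\<close>; the input at time \<open>n\<close> is
    therefore evaluated at the state of time \<open>n - 1\<close>.\<close>
  define h where "h p n = g (n - 1) (apply_bcontfun p (discrete (n - 1)))" for p n
  have h_diff: "norm (h p n - h q n) \<le> \<kappa> * dist p q" for p q n
    unfolding h_def using lip dist_bounded[of p "discrete (n - 1)" q] \<open>0 \<le> \<kappa>\<close>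
    by (metis dist_norm mult_left_mono order_trans)
  have h0: "norm (h 0 n) \<le> \<eta>" for n by (simp add: h_def g0)
  have h_le: "norm (h p n) \<le> \<eta> + \<kappa> * dist p 0" for p n
    using norm_triangle_sub[of "h p n" "h 0 n"] h_diff[of p n 0] h0[of n] by simp
  \<comment> \<open>The completeness instance for bounded continuous functions needs a metric domain, which
    \<open>int\<close> is not; hence the detour through \<open>int discrete\<close>.\<close>
  define G where "G p n = green (h p) (of_discrete n)" for p n
  have "G p \<in> bcontfun" for p
    using norm_green_le[of "h p", OF h_le]
    by (auto simp: bcontfun_def bounded_iff G_def continuous_on_topological
        intro!: exI[of _ "{_}"] open_discrete)
  then have app: "apply_bcontfun (Bcontfun (G p)) = G p" for p
    by (rule Bcontfun_inverse)
  have green_h: "norm (green (h p) n - green (h q) n) \<le> 1 / 2 * dist p q" for p q n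
  proof -
    have "norm (green (h p) n - green (h q) n) \<le> green_norm * (\<kappa> * dist p q)"
      unfolding green_diff[of "h p" _ "h q", OF h_le h_le] by (rule norm_green_le) (rule h_diff)
    also have "\<dots> = (green_norm * \<kappa>) * dist p q" by simp
    also have "\<dots> \<le> 1 / 2 * dist p q"
      using small by (intro mult_right_mono) auto
    finally show ?thesis .
  qed
  have "\<exists>!p. Bcontfun (G p) = p"
  proof (rule banach_fix_type[where c = "1/2" and f = "\<lambda>p. Bcontfun (G p)"])
    show "\<forall>p q. dist (Bcontfun (G p)) (Bcontfun (G q)) \<le> 1/2 * dist p q"
      using green_h by (intro allI dist_bound) (simp add: app G_def dist_norm)
  qed auto
  then obtain p where "apply_bcontfun p = G p"
    by (metis app)
  define w where "w n = apply_bcontfun p (discrete n)" for n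
  have p: "apply_bcontfun p n = green (h p) (of_discrete n)" for n
    by (simp add: \<open>apply_bcontfun p = G p\<close> G_def)
  have w: "w n = green (h p) n" for n
    by (simp add: w_def p discrete_inverse)
  have "dist p 0 \<le> green_norm * \<eta> + 1 / 2 * dist p 0"
  proof (rule dist_bound)
    fix n :: "int discrete"
    let ?n = "of_discrete n"
    have "norm (green (h p) ?n) \<le> norm (green (h 0) ?n) + norm (green (h p) ?n - green (h 0) ?n)"
      by (metis add.commute norm_triangle_sub)
    also have "\<dots> \<le> green_norm * \<eta> + 1 / 2 * dist p 0"
      by (intro add_mono norm_green_le h0 green_h)
    finally show "dist (apply_bcontfun p n) (apply_bcontfun 0 n) \<le> green_norm * \<eta> + 1 / 2 * dist p 0"
      by (simp add: p)
  qed
  then have "norm (w n) \<le> 2 * green_norm * \<eta>" for n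
    using dist_bounded[of p "discrete n" 0] by (simp add: w_def)
  moreover have "w (n + 1) = T (real_of_int (n + 1)) (real_of_int n) (w n)
      + g n (w n) - P3 (real_of_int (n + 1)) (g n (w n))" for n
    using green_step[of "h p", OF h_le, of n] unfolding w[symmetric] by (simp add: h_def w_def)
  ultimately show thesis using that by blast
qed

end

section \<open>The perturbed equation, its time-one maps and shadowing\<close>

locale perturbed_dichotomous_ode = dichotomous_ode A N P1 P2 P3 D b d
  for A :: "real \<Rightarrow> 'a::banach \<Rightarrow>\<^sub>L 'a" and N P1 P2 P3 D b d +
  fixes f :: "real \<Rightarrow> 'a \<Rightarrow> 'a" and c :: real
  assumes continuous_f: "continuous_on UNIV (\<lambda>(t, x). f t x)"
    and f_zero: "f t 0 = 0"
    and lipschitz_f: "norm (f t x - f t y) \<le> c * norm (x - y)"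
    and c_pos: "0 < c" and c_le_1: "c \<le> 1"
    and P3_idem: "P3 s (P3 s x) = P3 s x"
begin

abbreviation U :: "real \<Rightarrow> real \<Rightarrow> 'a \<Rightarrow> 'a" where
  "U \<equiv> nonlinear_evolution A f"

text \<open>The exponential factor of \<open>gronwall_bound\<close> with rate
  \<open>K = N + c\<close> over one unit of time.\<close>

definition E :: real where
  "E = exp (2 * (N + c))"

lemma E_ge_1: "1 \<le> E"
  using N_pos c_pos by (simp add: E_def)

lemma perturbed_field_lipschitz:
  "norm (perturbed_field A f t x - perturbed_field A f t y) \<le> (N + c) * norm (x - y)"
proof -
  have "norm (blinfun_apply (A t) (x - y) + (f t x - f t y)) \<le> N * norm (x - y) + c * norm (x - y)"
    by (intro order_trans[OF norm_triangle_ineq] add_mono norm_A_apply lipschitz_f)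
  then show ?thesis
    by (simp add: perturbed_field_def blinfun.diff_right algebra_simps)
qed

sublocale perturbed: lipschitz_field "perturbed_field A f" "N + c"
proof
  have "continuous_on UNIV (\<lambda>p. blinfun_apply (A (fst p)) (snd p) + (\<lambda>(t, x). f t x) p)"
    by (intro continuous_on_add bounded_bilinear.continuous_on[OF bounded_bilinear_blinfun_apply]
        continuous_A_fst continuous_on_snd continuous_on_id continuous_f)
  then show "continuous_on UNIV (\<lambda>(t, x). perturbed_field A f t x)"
    by (simp add: perturbed_field_def case_prod_beta)
  show "perturbed_field A f t 0 = 0" for t
    by (simp add: perturbed_field_def f_zero)
qed (use N_pos c_pos perturbed_field_lipschitz in auto)

lemma U_initial [simp]: "U s s x = x"
  by (simp add: nonlinear_evolution_def)

lemma U_derivative: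
  "((\<lambda>t. U t s x) has_vector_derivative perturbed_field A f t (U t s x)) (at t)"
  unfolding nonlinear_evolution_def by (rule perturbed.ode_flow_derivative)

lemma unit_time_gronwall:
  fixes r :: "real \<Rightarrow> 'a"
  assumes "0 \<le> \<delta>" and "s \<le> t" "t \<le> s + 1"
    and r: "\<And>\<tau>. (r has_vector_derivative r' \<tau>) (at \<tau>)"
    and r': "\<And>\<tau>. s \<le> \<tau> \<Longrightarrow> \<tau> \<le> t \<Longrightarrow> norm (r' \<tau>) \<le> (N + c) * norm (r \<tau>) + \<delta>"
  shows "norm (r t) \<le> 2 * (norm (r s) + \<delta>) * E"
proof -
  have "norm (r t) \<le> 2 * (norm (r s) + \<delta> * (t - s)) * exp (2 * (N + c) * (t - s))"
    by (rule gronwall_bound) (use assms N_pos c_pos in auto)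
  also have "\<dots> \<le> 2 * (norm (r s) + \<delta>) * E"
    unfolding E_def
  proof (intro mult_mono)
    show "norm (r s) + \<delta> * (t - s) \<le> norm (r s) + \<delta>"
      using assms(1-3) mult_left_mono[of "t - s" 1 \<delta>] by simp
    show "exp (2 * (N + c) * (t - s)) \<le> exp (2 * (N + c))"
      using assms(2,3) N_pos c_pos mult_left_mono[of "t - s" 1 "2 * (N + c)"] by simp
  qed (use assms in auto)
  finally show ?thesis .
qed

text \<open>The derivative of the difference is at most \<open>N + c\<close> times the difference,
  by the Lipschitz bound, plus the defect \<open>\<delta>\<close>. The case
  \<open>\<delta> = 0\<close> compares two exact solutions.\<close>

lemma U_stays_close:
  assumes y: "\<And>t. (y has_vector_derivative y' t) (at t)"
    and pseudo: "\<And>t. norm (y' t - perturbed_field A f t (y t)) \<le> \<delta>"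
    and "s \<le> t" "t \<le> s + 1"
  shows "norm (U t s x - y t) \<le> 2 * (norm (x - y s) + \<delta>) * E"
proof -
  have "norm (U t s x - y t) \<le> 2 * (norm (U s s x - y s) + \<delta>) * E"
  proof (rule unit_time_gronwall[where r = "\<lambda>t. U t s x - y t"])
    show "((\<lambda>t. U t s x - y t) has_vector_derivative
        perturbed_field A f \<tau> (U \<tau> s x) - y' \<tau>) (at \<tau>)" for \<tau>
      by (intro has_vector_derivative_diff U_derivative y)
    show "norm (perturbed_field A f \<tau> (U \<tau> s x) - y' \<tau>) \<le> (N + c) * norm (U \<tau> s x - y \<tau>) + \<delta>" for \<tau>
      using perturbed_field_lipschitz[of \<tau> "U \<tau> s x" "y \<tau>"] pseudo[of \<tau>]
        norm_triangle_ineq4[of "perturbed_field A f \<tau> (U \<tau> s x) - perturbed_field A f \<tau> (y \<tau>)"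
          "y' \<tau> - perturbed_field A f \<tau> (y \<tau>)"] by simp
  qed (use assms order_trans[OF norm_ge_zero pseudo] in auto)
  then show ?thesis by simp
qed

lemma U_lipschitz:
  assumes "s \<le> t" "t \<le> s + 1"
  shows "norm (U t s x - U t s y) \<le> 2 * E * norm (x - y)"
  using U_stays_close[where y = "\<lambda>t. U t s y" and s = s and t = t and \<delta> = 0 and x = x, OF U_derivative] assms by (simp add: mult_ac)

text \<open>The remainder \<open>?r\<close> vanishes at \<open>s\<close> and solves the linear
  equation with inhomogeneity \<open>f \<tau> (U \<tau> s x) - f \<tau> (U \<tau> s y)\<close>. By
  \<open>U_lipschitz\<close> this is at most \<open>?\<delta>\<close>, and Gronwall contributes a
  further factor \<open>2 * E\<close>. The factor \<open>c\<close> makes this a small Lipschitz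
  constant for the fixed-point argument.\<close>

lemma time_one_map_nearly_linear:
  "norm (U (s + 1) s x - U (s + 1) s y - T (s + 1) s (x - y)) \<le> 4 * c * E\<^sup>2 * norm (x - y)"
proof -
  let ?r = "\<lambda>t. U t s x - U t s y - T t s (x - y)"
  let ?\<delta> = "c * (2 * E * norm (x - y))"
  have "norm (?r (s + 1)) \<le> 2 * (norm (?r s) + ?\<delta>) * E"
  proof (rule unit_time_gronwall)
    show "(?r has_vector_derivative perturbed_field A f \<tau> (U \<tau> s x) - perturbed_field A f \<tau> (U \<tau> s y)
        - A \<tau> (T \<tau> s (x - y))) (at \<tau>)" for \<tau>
      by (intro has_vector_derivative_diff U_derivative T_apply_derivative)
    fix \<tau> assume \<tau>: "s \<le> \<tau>" "\<tau> \<le> s + 1"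
    have deriv_eq: "perturbed_field A f \<tau> (U \<tau> s x) - perturbed_field A f \<tau> (U \<tau> s y)
        - A \<tau> (T \<tau> s (x - y)) = A \<tau> (?r \<tau>) + (f \<tau> (U \<tau> s x) - f \<tau> (U \<tau> s y))"
      by (simp add: perturbed_field_def blinfun.diff_right)
    have "norm (f \<tau> (U \<tau> s x) - f \<tau> (U \<tau> s y)) \<le> ?\<delta>"
      using c_pos U_lipschitz[OF \<tau>, of x y]
      by (intro order_trans[OF lipschitz_f] mult_left_mono) auto
    then have "norm (A \<tau> (?r \<tau>) + (f \<tau> (U \<tau> s x) - f \<tau> (U \<tau> s y))) \<le> N * norm (?r \<tau>) + ?\<delta>"
      by (intro order_trans[OF norm_triangle_ineq] add_mono norm_A_apply)
    also have "\<dots> \<le> (N + c) * norm (?r \<tau>) + ?\<delta>"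
      using c_pos by (simp add: distrib_right)
    finally show "norm (perturbed_field A f \<tau> (U \<tau> s x) - perturbed_field A f \<tau> (U \<tau> s y)
        - A \<tau> (T \<tau> s (x - y))) \<le> (N + c) * norm (?r \<tau>) + ?\<delta>"
      unfolding deriv_eq .
  qed (use c_pos E_ge_1 in auto)
  then show ?thesis by (simp add: power2_eq_square mult_ac)
qed

text \<open>\<open>\<eta>\<close> bounds the defect of the pseudo-orbit over one time step, so
  \<open>green_fixpoint\<close> gives corrections of size \<open>2 * green_norm * \<eta>\<close> at
  the integers. Between integers \<open>U_stays_close\<close> costs another factor
  \<open>2 * E\<close>.\<close>

lemma shadowing:
  assumes small: "green_norm * (4 * c * E\<^sup>2) \<le> 1 / 2"
    and y: "\<And>t. (y has_vector_derivative y' t) (at t)"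
    and pseudo: "\<And>t. norm (y' t - perturbed_field A f t (y t)) \<le> \<delta>"
  defines "\<eta> \<equiv> 2 * \<delta> * E"
  obtains x z where "\<And>n :: int. ode_solution_on (perturbed_field A f)
      {real_of_int n <..< real_of_int n + 1} x"
    and "\<And>t. norm (x t - y t) \<le> 2 * (2 * green_norm * \<eta> + \<delta>) * E"
    and "\<And>n. norm (z n) \<le> (1 + 2 * D) * (2 * \<eta>)"
    and "\<And>n. P3 (real_of_int n) (z n) = z n"
    and "\<And>n. x (real_of_int (n + 1)) =
        U (real_of_int (n + 1)) (real_of_int n) (x (real_of_int n)) + z (n + 1)"
proof -
  define Y where "Y n = y (real_of_int n)" for n
  define F where "F n = U (real_of_int n + 1) (real_of_int n)" for n
  define g where "g n w = F n (Y n + w) - T (real_of_int n + 1) (real_of_int n) w - Y (n + 1)" for n w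
  have g0: "norm (g n 0) \<le> \<eta>" for n
    using U_stays_close[OF y pseudo, of "real_of_int n" "real_of_int n + 1" "Y n"]
    by (simp add: g_def F_def Y_def \<eta>_def mult_ac)
  have g_lip: "norm (g n v - g n w) \<le> 4 * c * E\<^sup>2 * norm (v - w)" for n v w
    using time_one_map_nearly_linear[of "real_of_int n" "Y n + v" "Y n + w"]
    by (simp add: g_def F_def blinfun.diff_right algebra_simps)
  obtain w where w_le: "\<And>n. norm (w n) \<le> 2 * green_norm * \<eta>"
    and w: "\<And>n. w (n + 1) = T (real_of_int (n + 1)) (real_of_int n) (w n)
        + g n (w n) - P3 (real_of_int (n + 1)) (g n (w n))"
    using green_fixpoint[of g, OF g0 g_lip _ small] c_pos by (metis less_imp_le zero_le_mult_iff zero_le_numeral zero_le_power2)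
  \<comment> \<open>In \<open>Y (n + 1) + w (n + 1)\<close> the terms \<open>Y (n + 1)\<close> and
    \<open>T w\<close> cancel against those inside \<open>g n (w n)\<close>. What remains is
    \<open>F n (Y n + w n)\<close> and this central jump.\<close>
  define z where "z n = - P3 (real_of_int n) (g (n - 1) (w (n - 1)))" for n
  \<comment> \<open>The orbit restarts from the corrected value \<open>Y n + w n\<close> at every
    integer \<open>n\<close> and follows the exact flow until the next one.\<close>
  define x where "x t = U t \<lfloor>t\<rfloor> (Y \<lfloor>t\<rfloor> + w \<lfloor>t\<rfloor>)" for t
  have x_int: "x (real_of_int n) = Y n + w n" for n
    by (simp add: x_def)
  have \<delta>: "0 \<le> \<delta>" by (rule order_trans[OF norm_ge_zero pseudo])
  show thesis
  proof (rule that[of x z])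
    fix n :: int
    show "ode_solution_on (perturbed_field A f) {real_of_int n <..< real_of_int n + 1} x"
      unfolding ode_solution_on_def
    proof
      fix t assume t: "t \<in> {real_of_int n <..< real_of_int n + 1}"
      have x_eq: "x \<tau> = U \<tau> n (Y n + w n)" if "\<tau> \<in> {real_of_int n <..< real_of_int n + 1}" for \<tau>
      proof -
        have "\<lfloor>\<tau>\<rfloor> = n" using that by (intro floor_unique) auto
        then show ?thesis by (simp add: x_def)
      qed
      have "((\<lambda>t. U t n (Y n + w n)) has_vector_derivative perturbed_field A f t (x t)) (at t)"
        unfolding x_eq[OF t] by (rule U_derivative)
      then have "(x has_vector_derivative perturbed_field A f t (x t)) (at t)"
        by (rule has_vector_derivative_transform_within_open[OF _ open_greaterThanLessThan t])
          (simp add: x_eq)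
      then show "(x has_vector_derivative perturbed_field A f t (x t))
          (at t within {real_of_int n <..< real_of_int n + 1})"
        by (rule has_vector_derivative_at_within)
    qed
  next
    fix t
    have "norm (x t - y t) \<le> 2 * (norm (Y \<lfloor>t\<rfloor> + w \<lfloor>t\<rfloor> - y \<lfloor>t\<rfloor>) + \<delta>) * E"
      unfolding x_def by (rule U_stays_close[OF y pseudo]) linarith+
    also have "\<dots> \<le> 2 * (2 * green_norm * \<eta> + \<delta>) * E"
      using w_le[of "\<lfloor>t\<rfloor>"] E_ge_1 by (intro mult_right_mono mult_left_mono add_right_mono) (auto simp: Y_def)
    finally show "norm (x t - y t) \<le> 2 * (2 * green_norm * \<eta> + \<delta>) * E" .
  next
    fix n :: int
    let ?m = "n - 1"
    have \<eta>: "0 \<le> \<eta>" by (rule order_trans[OF norm_ge_zero g0])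
    \<comment> \<open>The bound on \<open>w\<close> and the smallness assumption make the nonlinear
      increment at most \<open>\<eta>\<close>, so \<open>g\<close> at most doubles its bound at
      0.\<close>
    have "norm (g ?m (w ?m)) \<le> norm (g ?m 0) + norm (g ?m (w ?m) - g ?m 0)"
      by (metis add.commute norm_triangle_sub)
    also have "\<dots> \<le> \<eta> + 4 * c * E\<^sup>2 * (2 * green_norm * \<eta>)"
      using c_pos w_le[of ?m] g_lip[of ?m "w ?m" 0]
      by (intro add_mono g0 order_trans[OF g_lip] mult_left_mono) auto
    also have "\<dots> = \<eta> + (green_norm * (4 * c * E\<^sup>2)) * (2 * \<eta>)" by simp
    also have "\<dots> \<le> \<eta> + 1 / 2 * (2 * \<eta>)"
      using small \<eta> by (intro add_left_mono mult_right_mono) auto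
    finally have "norm (g ?m (w ?m)) \<le> 2 * \<eta>" by simp
    then have "norm (P3 n) * norm (g ?m (w ?m)) \<le> (1 + 2 * D) * (2 * \<eta>)"
      using D_pos by (intro mult_mono norm_P3_le) auto
    then show "norm (z n) \<le> (1 + 2 * D) * (2 * \<eta>)"
      unfolding z_def norm_minus_cancel by (rule order_trans[OF norm_blinfun])
  next
    show "P3 (real_of_int n) (z n) = z n" for n
      by (simp add: z_def blinfun.minus_right P3_idem)
    show "x (real_of_int (n + 1)) =
        U (real_of_int (n + 1)) (real_of_int n) (x (real_of_int n)) + z (n + 1)" for n
      unfolding x_int w z_def by (simp add: g_def F_def)
  qed
qed

end

section \<open>Uniform choice of the constants\<close>

theorem theorem4:
  fixes A :: "real \<Rightarrow> 'a::banach \<Rightarrow>\<^sub>L 'a"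
    and P1 P2 P3 :: "real \<Rightarrow> 'a \<Rightarrow>\<^sub>L 'a"
  assumes "continuous_on UNIV A"
    and "bdd_above (range (\<lambda>t. norm (A t)))"
    and "partial_exp_dichotomy A P1 P2 P3"
  shows "\<exists>c0>0. \<forall>c f. 0 < c \<and> c \<le> c0 \<and>
      continuous_on UNIV (\<lambda>(t, x). f t x) \<and>
      (\<forall>t. f t 0 = 0) \<and>
      (\<forall>t x y. norm (f t x - f t y) \<le> c * norm (x - y)) \<longrightarrow>
    (\<exists>L>0. \<forall>\<epsilon>>0. \<forall>y :: real \<Rightarrow> 'a.
      (\<forall>t. y differentiable (at t)) \<and>
      (\<forall>t. norm (vector_derivative y (at t) - blinfun_apply (A t) (y t) - f t (y t)) \<le> L * \<epsilon>) \<longrightarrow>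
      (\<exists>x :: real \<Rightarrow> 'a.
        (\<forall>n :: int. ode_solution_on (perturbed_field A f)
            {real_of_int n <..< real_of_int n + 1} x) \<and>
        (\<forall>t. norm (x t - y t) \<le> \<epsilon>) \<and>
        (\<exists>z :: int \<Rightarrow> 'a. bounded (range z) \<and> adapted_sup_norm P3 z \<le> \<epsilon> \<and>
          (\<forall>n :: int. x (real_of_int (n + 1)) =
             nonlinear_evolution A f (real_of_int (n + 1)) (real_of_int n) (x (real_of_int n))
             + blinfun_apply (P3 (real_of_int (n + 1))) (z (n + 1))))))"
proof -
  obtain N0 where N0: "\<And>t. norm (A t) \<le> N0"
    using assms(2) by (auto simp: bdd_above_def)
  \<comment> \<open>Since \<open>N\<close> becomes the Lipschitz constant of the operator equation,
    it must be positive.\<close>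
  define N where "N = max 1 N0"
  obtain D b d where D: "D > 0" and b: "b > 0" and d: "d > 0"
    and stable: "\<And>t s. s \<le> t \<Longrightarrow> norm (linear_evolution A t s o\<^sub>L P1 s) \<le> D * exp (- d * (t - s))"
    and unstable: "\<And>t s. t \<le> s \<Longrightarrow> norm (linear_evolution A t s o\<^sub>L P2 s) \<le> D * exp (- b * (s - t))"
    and P_sum: "\<And>s. P1 s + P2 s + P3 s = id_blinfun"
    and "\<And>s. P3 s o\<^sub>L P3 s = P3 s"
    using assms(3) unfolding partial_exp_dichotomy_def by metis
  then have P3_idem: "P3 s (P3 s x) = P3 s x" for s x
    by (metis blinfun_apply_blinfun_compose)
  interpret dichotomous_ode A N P1 P2 P3 D b d
    by unfold_locales
      (use assms(1) N0 P_sum D b d stable unstable in \<open>auto simp: N_def intro: order_trans[OF N0]\<close>)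
  \<comment> \<open>\<open>E\<close> depends on \<open>c\<close>; its value at \<open>c = 1\<close>
    dominates it for all admissible \<open>c\<close> and allows constants chosen before
    \<open>c\<close> and \<open>f\<close>.\<close>
  define E1 where "E1 = exp (2 * (N + 1))"
  \<comment> \<open>The sum of the tracking bound and the jump bound from \<open>shadowing\<close>,
    taken at \<open>\<delta> = 1\<close> with \<open>E1\<close> for \<open>E\<close>. It dominates
    each of them, so \<open>L = 1 / C\<close> yields both estimates.\<close>
  define C where "C = 2 * (4 * green_norm * E1 + 1) * E1 + (1 + 2 * D) * (4 * E1)"
  have E1: "0 < E1" by (simp add: E1_def)
  have C: "0 < C"
    using E1 D green_norm_pos unfolding C_def by (intro add_pos_pos mult_pos_pos) auto
  \<comment> \<open>The second entry is the threshold for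
    \<open>green_norm * (4 * c * E1\<^sup>2) \<le> 1 / 2\<close>; the first ensures
    \<open>E \<le> E1\<close>.\<close>
  define c0 where "c0 = min 1 (1 / (8 * green_norm * E1\<^sup>2))"
  have c0: "c0 > 0" using E1 green_norm_pos by (simp add: c0_def)
  show ?thesis
  proof (rule exI[of _ c0], intro conjI c0 allI impI, rule exI[of _ "1 / C"],
      intro conjI allI impI, goal_cases)
    case (1 c f)
    then show ?case using C by simp
  next
    case (2 c f \<epsilon> y)
    interpret perturbed_dichotomous_ode A N P1 P2 P3 D b d f c
      by unfold_locales (use 2 P3_idem in \<open>auto simp: c0_def\<close>)
    have E_le: "E \<le> E1" using c_le_1 by (simp add: E_def E1_def)
    have small: "green_norm * (4 * c * E\<^sup>2) \<le> 1 / 2"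
    proof -
      have "green_norm * (4 * c * E\<^sup>2) \<le> green_norm * (4 * c0 * E1\<^sup>2)"
        using 2 E_le E_ge_1 c_pos c0 green_norm_pos by (intro mult_left_mono mult_mono power_mono) auto
      also have "\<dots> \<le> green_norm * (4 * (1 / (8 * green_norm * E1\<^sup>2)) * E1\<^sup>2)"
        using green_norm_pos by (intro mult_left_mono mult_right_mono) (auto simp: c0_def)
      also have "\<dots> = 1 / 2" using green_norm_pos E1 by simp
      finally show ?thesis .
    qed
    define \<delta> where "\<delta> = 1 / C * \<epsilon>"
    have \<delta>: "0 \<le> \<delta>" and C_\<delta>: "C * \<delta> = \<epsilon>"
      using 2 C by (auto simp: \<delta>_def)
    have y: "(y has_vector_derivative vector_derivative y (at t)) (at t)" for t
      using 2 by (simp add: vector_derivative_works)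
    have pseudo: "norm (vector_derivative y (at t) - perturbed_field A f t (y t)) \<le> \<delta>" for t
      using 2 by (simp add: perturbed_field_def \<delta>_def diff_diff_eq)
    obtain x z where x: "\<And>n :: int. ode_solution_on (perturbed_field A f)
        {real_of_int n <..< real_of_int n + 1} x"
      and x_y: "\<And>t. norm (x t - y t) \<le> 2 * (2 * green_norm * (2 * \<delta> * E) + \<delta>) * E"
      and z: "\<And>n. norm (z n) \<le> (1 + 2 * D) * (2 * (2 * \<delta> * E))"
      and P3_z: "\<And>n. P3 (real_of_int n) (z n) = z n"
      and x_step: "\<And>n. x (real_of_int (n + 1)) =
        U (real_of_int (n + 1)) (real_of_int n) (x (real_of_int n)) + z (n + 1)"
      using shadowing[OF small y pseudo] by metis
    have "2 * (2 * green_norm * (2 * \<delta> * E) + \<delta>) * E \<le> 2 * (2 * green_norm * (2 * \<delta> * E1) + \<delta>) * E1"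
      using \<delta> E_le E_ge_1 green_norm_pos by (intro mult_mono add_mono) auto
    moreover have "(1 + 2 * D) * (2 * (2 * \<delta> * E)) \<le> (1 + 2 * D) * (2 * (2 * \<delta> * E1))"
      using \<delta> E_le D by (intro mult_left_mono) auto
    moreover have "C * \<delta> = 2 * (2 * green_norm * (2 * \<delta> * E1) + \<delta>) * E1 + (1 + 2 * D) * (2 * (2 * \<delta> * E1))"
      by (simp add: C_def algebra_simps)
    moreover have "0 \<le> 2 * (2 * green_norm * (2 * \<delta> * E1) + \<delta>) * E1"
      and "0 \<le> (1 + 2 * D) * (2 * (2 * \<delta> * E1))"
      using \<delta> E1 D green_norm_pos by auto
    ultimately have bounds: "2 * (2 * green_norm * (2 * \<delta> * E) + \<delta>) * E \<le> \<epsilon>"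
        "(1 + 2 * D) * (2 * (2 * \<delta> * E)) \<le> \<epsilon>"
      using C_\<delta> by linarith+
    have z_le: "norm (z n) \<le> \<epsilon>" for n
      by (rule order_trans[OF z bounds(2)])
    \<comment> \<open>By \<open>P3_z\<close> the central part of \<open>z\<close> is
      \<open>z\<close> itself and the complementary part is zero, so \<open>z_le\<close> controls
      both suprema.\<close>
    have "adapted_sup_norm P3 z \<le> \<epsilon>"
      using 2 z_le by (auto simp: adapted_sup_norm_def P3_z intro!: cSUP_least)
    moreover have "bounded (range z)"
      using z_le by (auto simp: bounded_iff)
    moreover have "norm (x t - y t) \<le> \<epsilon>" for t
      by (rule order_trans[OF x_y bounds(1)])
    ultimately show ?case
      using x x_step P3_z by (intro exI[of _ x] exI[of _ z] conjI allI) metis+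
  qed
qed

end
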